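(* Let $n\geq m\geq 1$ be integers. The number of $\alpha\in\mathcal{ODDP}_n$ with $f(\alpha)=m$ is $\binom{n}{m}$.
   Context: $X_n=\{1,2,\ldots,n\}$ and $\mathcal{I}_n$ is the symmetric inverse semigroup of all partial one-to-one maps of $X_n$ (including the empty map), with maps written on the right of their arguments. A map $\alpha\in\mathcal{I}_n$ is a partial isometry if $|x-y|=|x\alpha-y\alpha|$ for all $x,y\in\operatorname{Dom}\alpha$; it is order-decreasing if $x\alpha\leq x$ for all $x\in\operatorname{Dom}\alpha$; it is order-preserving if $x\leq y$ implies $x\alpha\leq y\alpha$ for all $x,y\in\operatorname{Dom}\alpha$. $\mathcal{ODDP}_n$ is the semigroup of all order-preserving, order-decreasing partial isometries of $X_n$. The fix of $\alpha$ is $f(\alpha)=|\{x\in\operatorname{Dom}\alpha: x\alpha=x\}|$. *)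

theory Defs
  imports Main
begin

text \<open>A partial map of \<open>{1..n}\<close> is an option-valued function on \<open>nat\<close> that is undefined
  (\<open>None\<close>) outside its domain, so distinct partial maps are distinct functions and can be
  counted with \<open>card\<close>. The right-hand notation \<open>x\<alpha>\<close> is \<open>the (\<alpha> x)\<close>, used only for
  \<open>x \<in> dom \<alpha>\<close>.\<close>

definition sym_inv_semigroup :: "nat \<Rightarrow> (nat \<rightharpoonup> nat) set" where
  "sym_inv_semigroup n = {\<alpha>. dom \<alpha> \<subseteq> {1..n} \<and> ran \<alpha> \<subseteq> {1..n} \<and> inj_on \<alpha> (dom \<alpha>)}"

text \<open>Distances are taken in \<open>int\<close>, since subtraction on \<open>nat\<close> truncates.\<close>

definition partial_isometry :: "(nat \<rightharpoonup> nat) \<Rightarrow> bool" where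
  "partial_isometry \<alpha> \<longleftrightarrow>
    (\<forall>x\<in>dom \<alpha>. \<forall>y\<in>dom \<alpha>. \<bar>int x - int y\<bar> = \<bar>int (the (\<alpha> x)) - int (the (\<alpha> y))\<bar>)"

definition order_decreasing :: "(nat \<rightharpoonup> nat) \<Rightarrow> bool" where
  "order_decreasing \<alpha> \<longleftrightarrow> (\<forall>x\<in>dom \<alpha>. the (\<alpha> x) \<le> x)"

definition order_preserving :: "(nat \<rightharpoonup> nat) \<Rightarrow> bool" where
  "order_preserving \<alpha> \<longleftrightarrow>
    (\<forall>x\<in>dom \<alpha>. \<forall>y\<in>dom \<alpha>. x \<le> y \<longrightarrow> the (\<alpha> x) \<le> the (\<alpha> y))"

definition ODDP :: "nat \<Rightarrow> (nat \<rightharpoonup> nat) set" where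
  "ODDP n = {\<alpha> \<in> sym_inv_semigroup n.
    order_preserving \<alpha> \<and> order_decreasing \<alpha> \<and> partial_isometry \<alpha>}"

definition fix_number :: "(nat \<rightharpoonup> nat) \<Rightarrow> nat" where
  "fix_number \<alpha> = card {x \<in> dom \<alpha>. the (\<alpha> x) = x}"

end

theory Submission
  imports Defs
begin

text \<open>Order-preserving isometries are translations: the displacement \<open>x\<alpha> - x\<close> is the same at
  every point of the domain. One fixed point therefore forces displacement \<open>0\<close> throughout, so
  (since \<open>m \<ge> 1\<close>) the maps to be counted are exactly the partial identities
  \<open>Some |` A\<close>, and the fix of such a map is the size of \<open>A\<close>. They correspond to the
  \<open>m\<close>-element subsets \<open>A\<close> of \<open>{1..n}\<close>.\<close>

text \<open>Order preservation gives \<open>x - y\<close> and \<open>x\<alpha> - y\<alpha>\<close> compatible signs, so the isometry equation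
  holds without the absolute values.\<close>

lemma order_preserving_isometry_displacement_const:
  assumes "order_preserving \<alpha>" "partial_isometry \<alpha>" "x \<in> dom \<alpha>" "y \<in> dom \<alpha>"
  shows "int (the (\<alpha> x)) - int x = int (the (\<alpha> y)) - int y"
proof -
  have "\<bar>int x - int y\<bar> = \<bar>int (the (\<alpha> x)) - int (the (\<alpha> y))\<bar>"
    using assms unfolding partial_isometry_def by blast
  moreover have "x \<le> y \<Longrightarrow> the (\<alpha> x) \<le> the (\<alpha> y)" "y \<le> x \<Longrightarrow> the (\<alpha> y) \<le> the (\<alpha> x)"
    using assms unfolding order_preserving_def by blast+
  ultimately show ?thesis
    by linarith
qed

lemma order_preserving_isometry_with_fixpoint:
  assumes "order_preserving \<alpha>" "partial_isometry \<alpha>" "\<alpha> z = Some z"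
  shows "\<alpha> = Some |` dom \<alpha>"
proof
  fix x
  show "\<alpha> x = (Some |` dom \<alpha>) x"
  proof (cases "x \<in> dom \<alpha>")
    case True
    then have "int (the (\<alpha> x)) - int x = int (the (\<alpha> z)) - int z"
      using assms by (intro order_preserving_isometry_displacement_const) auto
    with True assms(3) show ?thesis
      by auto
  qed (auto simp: restrict_map_def)
qed

lemma dom_partial_identity [simp]: "dom (Some |` A) = A"
  by (auto simp: restrict_map_def split: if_splits)

lemma partial_identity_in_ODDP:
  assumes "A \<subseteq> {1..n}"
  shows "Some |` A \<in> ODDP n"
proof -
  have "ran (Some |` A) = A"
    by (auto simp: ran_def restrict_map_def)
  moreover have "inj_on (Some |` A) A"
    by (auto simp: inj_on_def)
  ultimately show ?thesis
    using assms
    by (simp add: ODDP_def sym_inv_semigroup_def order_preserving_def order_decreasing_def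
        partial_isometry_def)
qed

lemma fix_number_partial_identity: "fix_number (Some |` A) = card A"
proof -
  have "{x \<in> A. the ((Some |` A) x) = x} = A"
    by auto
  then show ?thesis
    by (simp add: fix_number_def)
qed

text \<open>The assumption \<open>m \<ge> 1\<close> supplies the fixed point; without one, proper translations such as
  \<open>x \<mapsto> x - 1\<close> also occur.\<close>

lemma ODDP_with_fix_number:
  assumes "m \<ge> 1"
  shows "{\<alpha> \<in> ODDP n. fix_number \<alpha> = m} = (\<lambda>A. Some |` A) ` {A. A \<subseteq> {1..n} \<and> card A = m}"
    (is "?L = ?R")
proof
  show "?R \<subseteq> ?L"
    by (auto simp: partial_identity_in_ODDP fix_number_partial_identity)
  show "?L \<subseteq> ?R"
  proof
    fix \<alpha> assume \<alpha>: "\<alpha> \<in> ?L"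
    then have "card {x \<in> dom \<alpha>. the (\<alpha> x) = x} \<noteq> 0"
      using assms by (simp add: fix_number_def)
    then have "{x \<in> dom \<alpha>. the (\<alpha> x) = x} \<noteq> {}"
      by (metis card.empty)
    then obtain z where "\<alpha> z = Some z"
      by auto
    then have eq: "\<alpha> = Some |` dom \<alpha>"
      using \<alpha> by (intro order_preserving_isometry_with_fixpoint) (auto simp: ODDP_def)
    moreover have "card (dom \<alpha>) = m"
      using \<alpha> fix_number_partial_identity[of "dom \<alpha>"] eq by simp
    moreover have "dom \<alpha> \<subseteq> {1..n}"
      using \<alpha> by (simp add: ODDP_def sym_inv_semigroup_def)
    ultimately show "\<alpha> \<in> ?R"
      by blast
  qed
qed

theorem lemma2p5:
  fixes n m :: nat
  assumes "n \<ge> m" and "m \<ge> 1"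
  shows "card {\<alpha> \<in> ODDP n. fix_number \<alpha> = m} = n choose m"
proof -
  have "inj_on (\<lambda>A. Some |` A) {A. A \<subseteq> {1..n} \<and> card A = m}"
    by (metis dom_partial_identity inj_onI)
  then show ?thesis
    using assms(2) by (simp add: ODDP_with_fix_number card_image n_subsets)
qed

end
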